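(* Let $(X,\delta)$ be a complete metric space and let $X\subset Y$, where $Y$ is a set. Assume that $\varphi\colon X\to\mathbb{R}$ is a lower semicontinuous mapping having a finite lower bound. If $F\colon X\to 2^{Y}$ is a mapping such that for each $x\in X\setminus F(x)$ there exists a $z\in X\setminus\{x\}$ with $$\delta(x,z)\le\varphi(x)-\varphi(z),$$ then $F$ has a fixed point.
   Context: $2^{Y}$ is the family of all subsets of $Y$; a mapping $F\colon X\to 2^{Y}$ is understood to satisfy $X\neq\emptyset$ and $F(x)\neq\emptyset$ for all $x\in X$. "For each $x\in X\setminus F(x)$" means for each $x\in X$ with $x\notin F(x)$. Lower semicontinuity is with respect to $\delta$. A fixed point of $F$ is an $x\in X$ with $x\in F(x)$. *)

theory Defs
  imports "HOL-Analysis.Analysis"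
begin

definition lower_semicontinuous_map :: "'a topology \<Rightarrow> ('a \<Rightarrow> real) \<Rightarrow> bool" where
  "lower_semicontinuous_map T f \<longleftrightarrow>
     (\<forall>x\<in>topspace T. \<forall>a<f x. \<exists>U. openin T U \<and> x \<in> U \<and> (\<forall>y\<in>U. a < f y))"

end

theory Submission
  imports Defs
begin

text \<open>
  Call \<open>z\<close> reachable from \<open>x\<close> if \<open>\<delta> x z \<le> \<phi> x - \<phi> z\<close>: the decrease of \<open>\<phi>\<close> pays for the
  distance travelled. By the triangle inequality this is a partial order on \<open>X\<close>, and a fixed
  point is found by exhibiting a point from which nothing else is reachable (the order form of
  Ekeland's variational principle): the hypothesis on \<open>F\<close> says that a point outside its own image
  always reaches another one.

  Such a point is the limit of a greedy descent. Each term reaches the next, and the next one lies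
  at least halfway down from the current value of \<open>\<phi>\<close> to the infimum of \<open>\<phi>\<close> over everything
  reachable. Along the descent the values of \<open>\<phi>\<close> decrease to a limit \<open>L\<close>, so the distances, which
  are dominated by the decrease of \<open>\<phi>\<close>, form a Cauchy sequence. Lower semicontinuity passes
  reachability to the limit point \<open>x\<close>, and gives \<open>\<phi> x \<le> L\<close>. Anything reachable from \<open>x\<close> is
  reachable from every term, hence by greediness has value at least \<open>L\<close>; thus there is no
  decrease of \<open>\<phi>\<close> left to pay for a move away from \<open>x\<close>.
\<close>

text \<open>
  With \<open>I\<close> the infimum of \<open>\<phi>\<close> over the points reachable from \<open>x\<close>, the condition
  \<open>2 * \<phi> y - \<phi> x \<le> I\<close> says that \<open>\<phi> y\<close> is at most the midpoint of \<open>I\<close> and \<open>\<phi> x\<close>; greediness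
  is later applied to one reachable \<open>z\<close> at a time, hence the pointwise form. If \<open>I = \<phi> x\<close>, the
  point \<open>x\<close> itself serves, and otherwise the midpoint exceeds \<open>I\<close>.
\<close>

lemma (in Metric_space) exists_halfway_descent:
  fixes \<phi> :: "'a \<Rightarrow> real"
  assumes bdd: "bdd_below (\<phi> ` M)" and x: "x \<in> M"
  shows "\<exists>y\<in>M. d x y \<le> \<phi> x - \<phi> y \<and>
           (\<forall>z\<in>M. d x z \<le> \<phi> x - \<phi> z \<longrightarrow> 2 * \<phi> y - \<phi> x \<le> \<phi> z)"
proof -
  define S where "S = {z\<in>M. d x z \<le> \<phi> x - \<phi> z}"
  define I where "I = Inf (\<phi> ` S)"
  have xS: "x \<in> S" using x by (simp add: S_def)
  have bddS: "bdd_below (\<phi> ` S)"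
    by (rule bdd_below_mono[OF bdd]) (auto simp: S_def)
  have I_le: "I \<le> \<phi> z" if "z \<in> S" for z
    unfolding I_def using bddS that by (intro cInf_lower) auto
  have "\<exists>y\<in>S. 2 * \<phi> y - \<phi> x \<le> I"
  proof (cases "I < \<phi> x")
    case True
    then have "I < (I + \<phi> x) / 2" by simp
    then obtain y where "y \<in> S" "\<phi> y < (I + \<phi> x) / 2"
      using cInf_lessD[of "\<phi> ` S" "(I + \<phi> x) / 2"] xS unfolding I_def by blast
    then show ?thesis by (intro bexI[of _ y]) (simp_all add: field_simps)
  next
    case False
    then show ?thesis using xS by (intro bexI[of _ x]) auto
  qed
  then show ?thesis using I_le unfolding S_def by force
qed

text \<open>
  The triangle inequality bounds the distance from \<open>x\<close> to the limit by
  \<open>d x (\<sigma> n) + d (\<sigma> n) l \<le> \<phi> x - \<phi> (\<sigma> n) + d (\<sigma> n) l\<close>; here the last term vanishes in the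
  limit, and lower semicontinuity is precisely what allows \<open>\<phi> (\<sigma> n)\<close> to be replaced by \<open>\<phi> l\<close>.
\<close>

lemma (in Metric_space) descent_to_limit:
  fixes \<phi> :: "'a \<Rightarrow> real"
  assumes lsc: "lower_semicontinuous_map mtopology \<phi>"
    and lim: "limitin mtopology \<sigma> l sequentially"
    and x: "x \<in> M"
    and le: "\<forall>\<^sub>F n in sequentially. d x (\<sigma> n) \<le> \<phi> x - \<phi> (\<sigma> n)"
  shows "d x l \<le> \<phi> x - \<phi> l"
proof (rule field_le_epsilon)
  fix e :: real assume "e > 0"
  have l: "l \<in> M" using lim by (simp add: limitin_metric)
  have "\<phi> l - e/2 < \<phi> l" using \<open>e > 0\<close> by simp
  then obtain U where U: "openin mtopology U" "l \<in> U" "\<forall>y\<in>U. \<phi> l - e/2 < \<phi> y"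
    using lsc l unfolding lower_semicontinuous_map_def topspace_mtopology by blast
  have near: "\<forall>\<^sub>F n in sequentially. \<sigma> n \<in> M \<and> d (\<sigma> n) l < e/2"
    using lim half_gt_zero[OF \<open>e > 0\<close>] unfolding limitin_metric by blast
  have inU: "\<forall>\<^sub>F n in sequentially. \<sigma> n \<in> U"
    using lim U(1,2) by (simp add: limitin_def)
  obtain n where "\<sigma> n \<in> M" "d (\<sigma> n) l < e/2" "\<sigma> n \<in> U" "d x (\<sigma> n) \<le> \<phi> x - \<phi> (\<sigma> n)"
    using eventually_happens'[OF sequentially_bot eventually_conj[OF le eventually_conj[OF near inU]]]
    by blast
  with U(3) triangle[OF x, of "\<sigma> n" l] l show "d x l \<le> \<phi> x - \<phi> l + e"
    by fastforce
qed

text \<open>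
  The order form of Ekeland's variational principle. Completeness provides the limit of the greedy
  descent, and greediness makes this limit minimal.
\<close>

lemma (in Metric_space) exists_minimal_point:
  fixes \<phi> :: "'a \<Rightarrow> real"
  assumes complete: "mcomplete"
    and lsc: "lower_semicontinuous_map mtopology \<phi>"
    and bdd: "bdd_below (\<phi> ` M)"
    and nonempty: "M \<noteq> {}"
  shows "\<exists>x\<in>M. \<forall>z\<in>M. d x z \<le> \<phi> x - \<phi> z \<longrightarrow> z = x"
proof -
  obtain g where g: "\<And>x. x \<in> M \<Longrightarrow> g x \<in> M" "\<And>x. x \<in> M \<Longrightarrow> d x (g x) \<le> \<phi> x - \<phi> (g x)"
    and greedy: "\<And>x z. x \<in> M \<Longrightarrow> z \<in> M \<Longrightarrow> d x z \<le> \<phi> x - \<phi> z \<Longrightarrow> 2 * \<phi> (g x) - \<phi> x \<le> \<phi> z"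
    using exists_halfway_descent[OF bdd] by metis
  obtain x0 where x0: "x0 \<in> M" using nonempty by blast
  define s where "s n = (g ^^ n) x0" for n
  have sM: "s n \<in> M" for n by (induction n) (simp_all add: s_def x0 g)
  have sSuc: "s (Suc n) = g (s n)" for n by (simp add: s_def)
  have step: "d (s m) (s n) \<le> \<phi> (s m) - \<phi> (s n)" if "m \<le> n" for m n
    using that
  proof (induction n rule: dec_induct)
    case base
    then show ?case using sM by simp
  next
    case (step n)
    then show ?case
      using triangle[OF sM sM sM, of m "Suc n" n] g(2)[OF sM, of n] by (simp add: sSuc)
  qed
  have "decseq (\<lambda>n. \<phi> (s n))"
    unfolding decseq_def using step nonneg by (smt (verit))
  moreover obtain B where "\<And>y. y \<in> M \<Longrightarrow> B \<le> \<phi> y"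
    using bdd by (auto simp: bdd_below_def)
  ultimately obtain L where L: "(\<lambda>n. \<phi> (s n)) \<longlonglongrightarrow> L" "\<And>n. L \<le> \<phi> (s n)"
    using decseq_convergent[of "\<lambda>n. \<phi> (s n)" B] sM by blast
  have "MCauchy s"
    unfolding MCauchy_def
  proof (intro conjI allI impI)
    show "range s \<subseteq> M" using sM by blast
    fix e :: real assume "e > 0"
    then have "\<forall>\<^sub>F n in sequentially. \<phi> (s n) < L + e"
      using order_tendstoD(2)[OF L(1)] by simp
    then obtain N where N: "\<And>n. n \<ge> N \<Longrightarrow> \<phi> (s n) < L + e"
      by (auto simp: eventually_sequentially)
    have "d (s n) (s m) < e" if "N \<le> n" "n \<le> m" for n m
      using step[OF that(2)] N[OF that(1)] L(2)[of m] by linarith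
    then show "\<exists>N. \<forall>n n'. N \<le> n \<longrightarrow> N \<le> n' \<longrightarrow> d (s n) (s n') < e"
      by (metis commute linorder_le_cases)
  qed
  then obtain x where lim: "limitin mtopology s x sequentially"
    using complete unfolding mcomplete_def by blast
  then have x: "x \<in> M" by (simp add: limitin_metric)
  have reach: "d (s n) x \<le> \<phi> (s n) - \<phi> x" for n
    using step by (intro descent_to_limit[OF lsc lim sM] eventually_sequentiallyI[of n])
  have "\<phi> x \<le> \<phi> (s n)" for n
    using reach[of n] nonneg[of "s n" x] by linarith
  then have "\<phi> x \<le> L"
    by (intro LIMSEQ_le_const[OF L(1)]) simp
  have "z = x" if z: "z \<in> M" "d x z \<le> \<phi> x - \<phi> z" for z
  proof -
    have "2 * \<phi> (s (Suc n)) - \<phi> (s n) \<le> \<phi> z" for n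
      using greedy[OF sM z(1), of n] triangle[OF sM x z(1), of n] reach[of n] z(2)
      by (simp add: sSuc)
    moreover have "(\<lambda>n. 2 * \<phi> (s (Suc n)) - \<phi> (s n)) \<longlonglongrightarrow> 2 * L - L"
      by (intro tendsto_intros LIMSEQ_Suc L(1))
    ultimately have "L \<le> \<phi> z"
      using LIMSEQ_le_const2[of _ "2 * L - L" "\<phi> z"] by auto
    then have "d x z \<le> 0" using z(2) \<open>\<phi> x \<le> L\<close> by linarith
    then show ?thesis using x z(1) nonneg[of x z] zero[of x z] by simp
  qed
  then show ?thesis using x by blast
qed

theorem theorem3p2:
  fixes X Y :: "'a set"
    and \<delta> :: "'a \<Rightarrow> 'a \<Rightarrow> real"
    and \<phi> :: "'a \<Rightarrow> real"
    and F :: "'a \<Rightarrow> 'a set"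
  assumes "Metric_space X \<delta>"
    and "Metric_space.mcomplete X \<delta>"
    and "X \<subseteq> Y"
    and "lower_semicontinuous_map (Metric_space.mtopology X \<delta>) \<phi>"
    and "bdd_below (\<phi> ` X)"
    and "X \<noteq> {}"
    and "F \<in> X \<rightarrow> Pow Y"
    and "\<And>x. x \<in> X \<Longrightarrow> F x \<noteq> {}"
    and "\<And>x. x \<in> X - F x \<Longrightarrow> \<exists>z\<in>X - {x}. \<delta> x z \<le> \<phi> x - \<phi> z"
  shows "\<exists>x\<in>X. x \<in> F x"
proof -
  obtain x where "x \<in> X" and min: "\<forall>z\<in>X. \<delta> x z \<le> \<phi> x - \<phi> z \<longrightarrow> z = x"
    using Metric_space.exists_minimal_point[OF assms(1,2,4,5,6)] by blast
  with assms(9)[of x] show ?thesis by blast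
qed

end
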